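(* Let $n_c\ge 2$, $n_v\ge 1$, $N\ge 1$, let $P_{ij}$ ($1\le i\le n_c$, $1\le j\le n_v$) be arbitrary $N\times N$ permutation matrices, and let $H=(P_{ij})$ be the resulting $n_cN\times n_vN$ matrix. For $i\neq j$ in $\{1,\dots,n_c\}$ put $C_{ij}=\sum_{k=1}^{n_v}P_{ik}P_{jk}^{\mathsf T}$ (over $\mathbb Z$), and let $C_H$ be the $n_c\times n_c$ block matrix with zero diagonal blocks and $(i,j)$ block $C_{ij}$ for $i\ne j$. Then the following are equivalent: (a) $\mathrm{girth}(H)>4$; (b) $C_{ij}\triangle 0=0$ for all $i,j\in\{1,\dots,n_c\}$, $i\ne j$; (c) the Tanner graph of $C_{ij}$ has no multiple edges, for all $i,j\in\{1,\dots,n_c\}$, $i\neq j$; (d) $\mathrm{girth}(C_H)>2$.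
   Context: The Tanner graph of a matrix with non-negative integer entries is the bipartite (multi)graph with one check node per row, one variable node per column, and as many edges between check node $a$ and variable node $b$ as the $(a,b)$ entry. $\mathrm{girth}(M)$ is the length of a shortest cycle in the Tanner graph of $M$ ($+\infty$ if there is none); a graph with multiple edges (some entry $\geq 2$) is said to have girth $2$. For non-negative integers $e,f$, $e\triangle f:=1$ if $e\ge 2$ and $f=0$, and $e\triangle f:=0$ otherwise; for matrices of equal size, $\triangle$ is applied entrywise. *)

theory Defs
  imports
    "Jordan_Normal_Form.Matrix"
    "HOL-Combinatorics.Permutations"
    "HOL-Library.Extended_Nat"
begin

record ('v, 'e) multigraph =
  verts :: "'v set"
  edges :: "'e set"
  ends :: "'e \<Rightarrow> 'v set"

text \<open>
  The edge \<open>es ! i\<close> joins \<open>vs ! i\<close> to its cyclic successor. Edges are tracked as well as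
  vertices, so that two parallel edges form a cycle of length 2, while traversing a single
  edge back and forth is not a cycle.
\<close>

definition is_cycle :: "('v, 'e) multigraph \<Rightarrow> 'v list \<Rightarrow> 'e list \<Rightarrow> bool" where
  "is_cycle G vs es \<longleftrightarrow>
     es \<noteq> [] \<and> length vs = length es \<and> distinct vs \<and> distinct es \<and>
     set vs \<subseteq> verts G \<and> set es \<subseteq> edges G \<and>
     (\<forall>i < length es. ends G (es ! i) = {vs ! i, vs ! (Suc i mod length es)})"

text \<open>The infimum of the empty set in \<^typ>\<open>enat\<close> is \<open>\<infinity>\<close>, as wanted for acyclic graphs.\<close>

definition graph_girth :: "('v, 'e) multigraph \<Rightarrow> enat" where
  "graph_girth G = Inf {enat (length es) | vs es. is_cycle G vs es}"

definition has_multiple_edges :: "('v, 'e) multigraph \<Rightarrow> bool" where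
  "has_multiple_edges G \<longleftrightarrow>
     (\<exists>e \<in> edges G. \<exists>e' \<in> edges G. e \<noteq> e' \<and> ends G e = ends G e')"

datatype tanner_node = Check nat | Var nat

text \<open>The edge \<open>(a, b, t)\<close> is the \<open>t\<close>-th of the parallel edges between check node \<open>a\<close> and
  variable node \<open>b\<close>.\<close>

definition tanner_graph :: "nat mat \<Rightarrow> (tanner_node, nat \<times> nat \<times> nat) multigraph" where
  "tanner_graph M =
     \<lparr> verts = Check ` {..<dim_row M} \<union> Var ` {..<dim_col M},
       edges = {(a, b, t). a < dim_row M \<and> b < dim_col M \<and> t < M $$ (a, b)},
       ends = (\<lambda>(a, b, t). {Check a, Var b}) \<rparr>"

definition girth :: "nat mat \<Rightarrow> enat" where
  "girth M = graph_girth (tanner_graph M)"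

definition triangle :: "nat \<Rightarrow> nat \<Rightarrow> nat" where
  "triangle e f = (if e \<ge> 2 \<and> f = 0 then 1 else 0)"

definition triangle_mat :: "nat mat \<Rightarrow> nat mat \<Rightarrow> nat mat" where
  "triangle_mat A B =
     mat (dim_row A) (dim_col A) (\<lambda>(r, c). triangle (A $$ (r, c)) (B $$ (r, c)))"

definition permutation_matrix :: "nat \<Rightarrow> nat mat \<Rightarrow> bool" where
  "permutation_matrix N A \<longleftrightarrow>
     (\<exists>p. p permutes {..<N} \<and> A = mat N N (\<lambda>(r, c). if c = p r then 1 else 0))"

definition block_mat :: "nat \<Rightarrow> nat \<Rightarrow> nat \<Rightarrow> (nat \<Rightarrow> nat \<Rightarrow> 'a mat) \<Rightarrow> 'a mat" where
  "block_mat m n N B =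
     mat (m * N) (n * N) (\<lambda>(r, c). B (r div N) (c div N) $$ (r mod N, c mod N))"

text \<open>The sum is taken entrywise because matrices of arbitrary dimension do not form a
  \<open>comm_monoid_add\<close>.\<close>

definition C_block :: "nat \<Rightarrow> nat \<Rightarrow> (nat \<Rightarrow> nat \<Rightarrow> nat mat) \<Rightarrow> nat \<Rightarrow> nat \<Rightarrow> nat mat" where
  "C_block nv N P i j =
     mat N N (\<lambda>(r, c). \<Sum>k<nv. (P i k * transpose_mat (P j k)) $$ (r, c))"

definition C_mat :: "nat \<Rightarrow> nat \<Rightarrow> nat \<Rightarrow> (nat \<Rightarrow> nat \<Rightarrow> nat mat) \<Rightarrow> nat mat" where
  "C_mat nc nv N P =
     block_mat nc nc N (\<lambda>i j. if i = j then 0\<^sub>m N N else C_block nv N P i j)"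

text \<open>With this notion of cycle, parallel edges give girth 2 without any special convention.\<close>

lemma girth_eq_2_if_multiple_edges:
  assumes "a < dim_row M" "b < dim_col M" "M $$ (a, b) \<ge> 2"
  shows "girth M = 2"
proof -
  let ?S = "{enat (length es) | vs es. is_cycle (tanner_graph M) vs es}"
  have "is_cycle (tanner_graph M) [Check a, Var b] [(a, b, 0), (a, b, 1)]"
    using assms by (auto simp: is_cycle_def tanner_graph_def less_Suc_eq)
  then have "2 \<in> ?S"
    by (force simp: numeral_eq_enat)
  moreover have "2 \<le> x" if "x \<in> ?S" for x
  proof -
    from that obtain vs es where x: "x = enat (length es)"
      and cyc: "is_cycle (tanner_graph M) vs es" by auto
    have "length es \<noteq> 1"
    proof
      assume "length es = 1"
      with cyc have "ends (tanner_graph M) (es ! 0) = {vs ! 0}"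
        by (auto simp: is_cycle_def)
      then show False
        by (cases "vs ! 0") (auto simp: tanner_graph_def split: prod.splits)
    qed
    moreover have "length es \<noteq> 0"
      using cyc by (simp add: is_cycle_def)
    ultimately have "2 \<le> length es"
      by linarith
    then show ?thesis
      by (simp add: x numeral_eq_enat)
  qed
  ultimately have "Inf ?S = 2"
    by (intro antisym Inf_lower Inf_greatest)
  then show ?thesis
    by (simp add: girth_def graph_girth_def)
qed

end

theory Submission
  imports Defs
begin

text \<open>
  A cycle of length at most 4 in a Tanner graph is either a pair of parallel edges or a rectangle
  of nonzero entries. In \<open>H\<close> there are no parallel edges, and since each \<open>P\<^sub>i\<^sub>k\<close> is a permutation
  matrix with permutation \<open>p\<^sub>i\<^sub>k\<close>, a rectangle has its rows in different block rows \<open>i \<noteq> j\<close> and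
  its columns in different block columns. The entry \<open>(r, c)\<close> of \<open>C\<^sub>i\<^sub>j\<close> counts the \<open>k\<close> with
  \<open>p\<^sub>i\<^sub>k r = p\<^sub>j\<^sub>k c\<close>, that is, the columns of \<open>H\<close> having a one in both of the corresponding rows,
  so rectangles are the same thing as entries of some \<open>C\<^sub>i\<^sub>j\<close> that are at least 2.
\<close>

section \<open>Girth bounds as bounds on cycle lengths\<close>

lemma graph_girth_gt_iff:
  "graph_girth G > enat n \<longleftrightarrow> (\<forall>vs es. is_cycle G vs es \<longrightarrow> length es > n)"
proof
  assume "graph_girth G > enat n"
  then show "\<forall>vs es. is_cycle G vs es \<longrightarrow> length es > n"
    unfolding graph_girth_def by (force dest: less_le_trans[OF _ Inf_lower])
next
  let ?S = "{enat (length es) | vs es. is_cycle G vs es}"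
  assume *: "\<forall>vs es. is_cycle G vs es \<longrightarrow> length es > n"
  \<comment> \<open>A strict bound on all elements would give only a weak one for
    \<open>Inf\<close>, so it is passed through as the weak bound \<open>Suc n\<close>. This
    includes the empty set, whose \<open>Inf\<close> is infinite.\<close>
  have "enat (Suc n) \<le> Inf ?S"
    using * by (auto intro!: Inf_greatest simp: Suc_le_eq)
  then show "graph_girth G > enat n"
    unfolding graph_girth_def by (rule less_le_trans[rotated]) simp
qed

section \<open>Simple matrices and girth greater than 2\<close>

text \<open>The common form to which all four conditions of the theorem are reduced, applied to the
  blocks \<open>C_block nv N P i j\<close> with \<open>i\<close> and \<open>j\<close>
  distinct.\<close>

definition simple_mat :: "nat mat \<Rightarrow> bool" where
  "simple_mat M \<longleftrightarrow> (\<forall>a<dim_row M. \<forall>b<dim_col M. M $$ (a, b) \<le> 1)"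

lemma not_simple_mat_iff:
  "\<not> simple_mat M \<longleftrightarrow> (\<exists>a<dim_row M. \<exists>b<dim_col M. M $$ (a, b) \<ge> 2)"
proof -
  have "2 \<le> n \<longleftrightarrow> \<not> n \<le> 1" for n :: nat by linarith
  then show ?thesis by (simp add: simple_mat_def)
qed

text \<open>The ends \<open>{Check a, Var b}\<close> determine \<open>a\<close> and
  \<open>b\<close>, so parallel edges differ only in the index \<open>t\<close>, and two values of
  \<open>t\<close> exist exactly if the entry is at least 2.\<close>

lemma has_multiple_edges_tanner_graph_iff:
  "has_multiple_edges (tanner_graph M) \<longleftrightarrow> \<not> simple_mat M"
proof
  assume "has_multiple_edges (tanner_graph M)"
  then show "\<not> simple_mat M"
    by (fastforce simp: has_multiple_edges_def tanner_graph_def simple_mat_def doubleton_eq_iff)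
next
  assume "\<not> simple_mat M"
  then obtain a b where ab: "a < dim_row M" "b < dim_col M" "M $$ (a, b) \<ge> 2"
    by (auto simp: simple_mat_def not_le)
  then show "has_multiple_edges (tanner_graph M)"
    unfolding has_multiple_edges_def
    by (intro bexI[of _ "(a, b, 0)"] bexI[of _ "(a, b, 1)"]) (auto simp: tanner_graph_def)
qed

text \<open>A cycle of length 1 would be a loop, whereas every edge joins a check node to a variable
  node.\<close>

lemma length_cycle_tanner_graph_ge_2:
  assumes "is_cycle (tanner_graph M) vs es"
  shows "length es \<ge> 2"
proof (rule ccontr)
  assume "\<not> length es \<ge> 2"
  moreover have "es \<noteq> []" using assms by (simp add: is_cycle_def)
  ultimately have "length es = 1" by (cases es) (auto simp: not_le less_Suc_eq numeral_2_eq_2)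
  then have "ends (tanner_graph M) (es ! 0) = {vs ! 0}"
    using assms by (auto simp: is_cycle_def)
  then show False
    by (cases "vs ! 0") (auto simp: tanner_graph_def split: prod.splits)
qed

lemma girth_gt_2_iff: "girth M > 2 \<longleftrightarrow> simple_mat M"
proof
  assume "girth M > 2"
  then show "simple_mat M"
    using girth_eq_2_if_multiple_edges[of _ M] by (force simp: simple_mat_def not_le)
next
  assume simple: "simple_mat M"
  have "length es > 2" if cyc: "is_cycle (tanner_graph M) vs es" for vs es
  proof (rule ccontr)
    assume "\<not> length es > 2"
    then have len: "length es = 2"
      using length_cycle_tanner_graph_ge_2[OF cyc] by simp
    then obtain e e' where es: "es = [e, e']"
      by (auto simp: length_Suc_conv numeral_2_eq_2)
    \<comment> \<open>The cyclic successor of the second node is the first, so both edges join the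
      same two nodes.\<close>
    have "ends (tanner_graph M) e = ends (tanner_graph M) e'" "e \<noteq> e'"
      "e \<in> edges (tanner_graph M)" "e' \<in> edges (tanner_graph M)"
      using cyc by (auto simp: is_cycle_def es less_Suc_eq)
    then have "has_multiple_edges (tanner_graph M)"
      by (auto simp: has_multiple_edges_def)
    with simple show False
      by (simp add: has_multiple_edges_tanner_graph_iff)
  qed
  then have "graph_girth (tanner_graph M) > enat 2"
    by (simp add: graph_girth_gt_iff)
  then show "girth M > 2"
    by (simp add: girth_def numeral_eq_enat)
qed

section \<open>Rectangles and girth greater than 4\<close>

definition has_rectangle :: "nat mat \<Rightarrow> bool" where
  "has_rectangle M \<longleftrightarrow>
     (\<exists>a<dim_row M. \<exists>a'<dim_row M. \<exists>b<dim_col M. \<exists>b'<dim_col M. a \<noteq> a' \<and> b \<noteq> b' \<and>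
        M $$ (a, b) > 0 \<and> M $$ (a, b') > 0 \<and> M $$ (a', b) > 0 \<and> M $$ (a', b') > 0)"

text \<open>With its counterpart for variable nodes, this follows a cycle node by node: each edge
  changes sides and certifies a nonzero entry.\<close>

lemma tanner_graph_ends_CheckE:
  assumes "ends (tanner_graph M) e = {Check a, y}" "e \<in> edges (tanner_graph M)"
  obtains b where "y = Var b" "a < dim_row M" "b < dim_col M" "M $$ (a, b) > 0"
proof -
  obtain a' b t where e: "e = (a', b, t)" by (cases e)
  show ?thesis
    using assms by (intro that[of b]) (auto simp: e tanner_graph_def doubleton_eq_iff)
qed

lemma tanner_graph_ends_VarE:
  assumes "ends (tanner_graph M) e = {Var b, y}" "e \<in> edges (tanner_graph M)"
  obtains a where "y = Check a" "a < dim_row M" "b < dim_col M" "M $$ (a, b) > 0"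
proof -
  obtain a b' t where e: "e = (a, b', t)" by (cases e)
  show ?thesis
    using assms by (intro that[of a]) (auto simp: e tanner_graph_def doubleton_eq_iff)
qed

text \<open>The graph is bipartite: after two edges the walk is back on its starting side, so the
  third edge would join two nodes of the same kind.\<close>

lemma no_tanner_graph_cycle_length_3:
  assumes "is_cycle (tanner_graph M) vs es"
  shows "length es \<noteq> 3"
proof
  assume "length es = 3"
  then have "ends (tanner_graph M) (es ! i) = {vs ! i, vs ! (Suc i mod 3)} \<and>
      es ! i \<in> edges (tanner_graph M)" if "i < 3" for i
    using assms that by (auto simp: is_cycle_def)
  from this[of 0] this[of 1] this[of 2]
  have ends: "ends (tanner_graph M) (es ! 0) = {vs ! 0, vs ! 1}" "es ! 0 \<in> edges (tanner_graph M)"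
    "ends (tanner_graph M) (es ! 1) = {vs ! 1, vs ! 2}" "es ! 1 \<in> edges (tanner_graph M)"
    "ends (tanner_graph M) (es ! 2) = {vs ! 2, vs ! 0}" "es ! 2 \<in> edges (tanner_graph M)"
    by (simp_all add: numeral_2_eq_2)
  show False
  proof (cases "vs ! 0")
    case (Check a)
    obtain b where b: "vs ! 1 = Var b"
      using tanner_graph_ends_CheckE[OF ends(1,2)[unfolded Check]] by metis
    obtain a' where a': "vs ! 2 = Check a'"
      using tanner_graph_ends_VarE[OF ends(3,4)[unfolded b]] by metis
    show False
      using tanner_graph_ends_CheckE[OF ends(5,6)[unfolded a' Check]] by blast
  next
    case (Var b)
    obtain a where a: "vs ! 1 = Check a"
      using tanner_graph_ends_VarE[OF ends(1,2)[unfolded Var]] by metis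
    obtain b' where b': "vs ! 2 = Var b'"
      using tanner_graph_ends_CheckE[OF ends(3,4)[unfolded a]] by metis
    show False
      using tanner_graph_ends_VarE[OF ends(5,6)[unfolded b' Var]] by blast
  qed
qed

lemma has_rectangle_if_tanner_graph_cycle_length_4:
  assumes cyc: "is_cycle (tanner_graph M) vs es" and len: "length es = 4"
  shows "has_rectangle M"
proof -
  have "ends (tanner_graph M) (es ! i) = {vs ! i, vs ! (Suc i mod 4)} \<and>
      es ! i \<in> edges (tanner_graph M)" if "i < 4" for i
    using cyc len that by (auto simp: is_cycle_def)
  note edge = this
  have succ: "Suc 0 mod 4 = 1" "Suc 1 mod 4 = 2" "Suc 2 mod 4 = 3" "Suc 3 mod 4 = 0"
    "0 < (4::nat)" "1 < (4::nat)" "2 < (4::nat)" "3 < (4::nat)"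
    by simp_all
  from edge[of 0] edge[of 1] edge[of 2] edge[of 3]
  have ends: "ends (tanner_graph M) (es ! 0) = {vs ! 0, vs ! 1}" "es ! 0 \<in> edges (tanner_graph M)"
    "ends (tanner_graph M) (es ! 1) = {vs ! 1, vs ! 2}" "es ! 1 \<in> edges (tanner_graph M)"
    "ends (tanner_graph M) (es ! 2) = {vs ! 2, vs ! 3}" "es ! 2 \<in> edges (tanner_graph M)"
    "ends (tanner_graph M) (es ! 3) = {vs ! 3, vs ! 0}" "es ! 3 \<in> edges (tanner_graph M)"
    by (simp_all only: succ)
  \<comment> \<open>Opposite nodes lie on the same side, so these inequalities yield distinct rows
    and distinct columns.\<close>
  have neq: "vs ! 0 \<noteq> vs ! 2" "vs ! 1 \<noteq> vs ! 3"
    using cyc len by (auto simp: is_cycle_def nth_eq_iff_index_eq)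
  show ?thesis
  proof (cases "vs ! 0")
    case (Check a)
    obtain b where b: "vs ! 1 = Var b" "a < dim_row M" "b < dim_col M" "M $$ (a, b) > 0"
      by (rule tanner_graph_ends_CheckE[OF ends(1,2)[unfolded Check]])
    obtain a' where a': "vs ! 2 = Check a'" "a' < dim_row M" "M $$ (a', b) > 0"
      by (rule tanner_graph_ends_VarE[OF ends(3,4)[unfolded b(1)]])
    obtain b' where b': "vs ! 3 = Var b'" "b' < dim_col M" "M $$ (a', b') > 0"
      by (rule tanner_graph_ends_CheckE[OF ends(5,6)[unfolded a'(1)]])
    have ab': "M $$ (a, b') > 0"
      by (rule tanner_graph_ends_VarE[OF ends(7,8)[unfolded b'(1) Check]]) simp
    have "a \<noteq> a'" "b \<noteq> b'"
      using neq Check b(1) a'(1) b'(1) by simp_all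
    then show ?thesis
      unfolding has_rectangle_def using b(2-) a'(2-) b'(2-) ab' by blast
  next
    case (Var b)
    obtain a where a: "vs ! 1 = Check a" "a < dim_row M" "b < dim_col M" "M $$ (a, b) > 0"
      by (rule tanner_graph_ends_VarE[OF ends(1,2)[unfolded Var]])
    obtain b' where b': "vs ! 2 = Var b'" "b' < dim_col M" "M $$ (a, b') > 0"
      by (rule tanner_graph_ends_CheckE[OF ends(3,4)[unfolded a(1)]])
    obtain a' where a': "vs ! 3 = Check a'" "a' < dim_row M" "M $$ (a', b') > 0"
      by (rule tanner_graph_ends_VarE[OF ends(5,6)[unfolded b'(1)]])
    have ab: "M $$ (a', b) > 0"
      by (rule tanner_graph_ends_CheckE[OF ends(7,8)[unfolded a'(1) Var]]) simp
    have "a \<noteq> a'" "b \<noteq> b'"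
      using neq Var a(1) a'(1) b'(1) by simp_all
    then show ?thesis
      unfolding has_rectangle_def using a(2-) a'(2-) b'(2-) ab by blast
  qed
qed

lemma girth_gt_4_iff: "girth M > 4 \<longleftrightarrow> simple_mat M \<and> \<not> has_rectangle M"
proof
  assume girth: "girth M > 4"
  have "(2::enat) < 4" by simp
  with girth have "girth M > 2" by (rule less_trans[rotated])
  then have "simple_mat M" by (simp add: girth_gt_2_iff)
  moreover have "\<not> has_rectangle M"
  proof
    assume "has_rectangle M"
    then obtain a a' b b' where
      "a < dim_row M" "a' < dim_row M" "b < dim_col M" "b' < dim_col M" "a \<noteq> a'" "b \<noteq> b'"
      "M $$ (a, b) > 0" "M $$ (a, b') > 0" "M $$ (a', b) > 0" "M $$ (a', b') > 0"
      by (auto simp: has_rectangle_def)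
    \<comment> \<open>Every nonzero entry has an edge with index 0.\<close>
    then have "is_cycle (tanner_graph M) [Check a, Var b, Check a', Var b']
        [(a, b, 0), (a', b, 0), (a', b', 0), (a, b', 0)]"
      by (auto simp: is_cycle_def tanner_graph_def less_Suc_eq)
    moreover from girth have "graph_girth (tanner_graph M) > enat 4"
      by (simp add: girth_def numeral_eq_enat)
    ultimately show False
      by (force simp: graph_girth_gt_iff)
  qed
  ultimately show "simple_mat M \<and> \<not> has_rectangle M" ..
next
  assume *: "simple_mat M \<and> \<not> has_rectangle M"
  then have "graph_girth (tanner_graph M) > enat 2"
    using girth_gt_2_iff[of M] by (simp add: girth_def numeral_eq_enat)
  then have "length es > 2" if "is_cycle (tanner_graph M) vs es" for vs es
    using that by (simp add: graph_girth_gt_iff)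
  moreover have "length es \<noteq> 3 \<and> length es \<noteq> 4" if "is_cycle (tanner_graph M) vs es" for vs es
    using no_tanner_graph_cycle_length_3[OF that] has_rectangle_if_tanner_graph_cycle_length_4[OF that] *
    by blast
  ultimately have "length es > 4" if "is_cycle (tanner_graph M) vs es" for vs es
    using that by fastforce
  then have "graph_girth (tanner_graph M) > enat 4"
    by (simp add: graph_girth_gt_iff)
  then show "girth M > 4"
    by (simp add: girth_def numeral_eq_enat)
qed

section \<open>The triangle operation and block matrices\<close>

lemma triangle_mat_zero_iff:
  assumes "M \<in> carrier_mat m n"
  shows "triangle_mat M (0\<^sub>m m n) = 0\<^sub>m m n \<longleftrightarrow> simple_mat M"
proof -
  have "triangle_mat M (0\<^sub>m m n) = 0\<^sub>m m n \<longleftrightarrow>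
      (\<forall>r<m. \<forall>c<n. \<not> 2 \<le> M $$ (r, c))"
    using assms by (auto simp: mat_eq_iff triangle_mat_def triangle_def)
  also have "\<dots> \<longleftrightarrow> simple_mat M"
    using assms not_simple_mat_iff[of M] by auto
  finally show ?thesis .
qed

lemma block_index_less:
  fixes i m r N :: nat
  assumes "i < m" "r < N"
  shows "i * N + r < m * N"
proof -
  have "i * N + r < Suc i * N" using assms by simp
  also have "\<dots> \<le> m * N" using assms by (intro mult_le_mono1) simp
  finally show ?thesis .
qed

lemma block_mat_index:
  assumes "i < m" "k < n" "r < N" "c < N"
  shows "block_mat m n N B $$ (i * N + r, k * N + c) = B i k $$ (r, c)"
  using assms by (simp add: block_mat_def block_index_less)

lemma block_index_cases:
  fixes a m N :: nat
  assumes "a < m * N"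
  obtains i r where "i < m" "r < N" "a = i * N + r"
proof
  have "N > 0" using assms by (cases N) auto
  then show "a mod N < N" by simp
  show "a div N < m" using assms by (simp add: less_mult_imp_div_less)
  show "a = a div N * N + a mod N" by simp
qed

text \<open>Serves twice: it excludes parallel edges in \<open>H\<close>, and it reduces the girth
  condition on \<open>C_mat\<close> to the single blocks.\<close>

lemma simple_mat_block_mat_iff:
  assumes "\<And>i k. i < m \<Longrightarrow> k < n \<Longrightarrow> B i k \<in> carrier_mat N N"
  shows "simple_mat (block_mat m n N B) \<longleftrightarrow> (\<forall>i<m. \<forall>k<n. simple_mat (B i k))"
proof -
  have "simple_mat (block_mat m n N B) \<longleftrightarrow>
      (\<forall>a<m * N. \<forall>b<n * N. block_mat m n N B $$ (a, b) \<le> 1)"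
    by (simp add: simple_mat_def block_mat_def)
  also have "\<dots> \<longleftrightarrow> (\<forall>i<m. \<forall>k<n. \<forall>r<N. \<forall>c<N. B i k $$ (r, c) \<le> 1)"
    (is "?L \<longleftrightarrow> ?R")
  proof
    assume ?L
    show ?R
    proof (intro allI impI)
      fix i k r c
      assume ikrc: "i < m" "k < n" "r < N" "c < N"
      then have "block_mat m n N B $$ (i * N + r, k * N + c) \<le> 1"
        using \<open>?L\<close> by (simp add: block_index_less)
      with ikrc show "B i k $$ (r, c) \<le> 1"
        by (simp add: block_mat_index)
    qed
  next
    assume ?R
    then show ?L
      by (auto elim!: block_index_cases simp: block_mat_index)
  qed
  also have "\<dots> \<longleftrightarrow> (\<forall>i<m. \<forall>k<n. simple_mat (B i k))"
  proof -
    have "simple_mat (B i k) \<longleftrightarrow> (\<forall>r<N. \<forall>c<N. B i k $$ (r, c) \<le> 1)"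
      if "i < m" "k < n" for i k
      using assms[OF that] by (simp add: simple_mat_def)
    then show ?thesis by simp
  qed
  finally show ?thesis .
qed

section \<open>Entries of the blocks of \<open>C_mat\<close>\<close>

text \<open>Each summand is the inner product of row \<open>r\<close> of \<open>P i k\<close> and
  row \<open>c\<close> of \<open>P j k\<close>. Both rows contain a single one, at
  \<open>p i k r\<close> and \<open>p j k c\<close>, so the product is 1 if these positions agree
  and 0 otherwise.\<close>

lemma C_block_index:
  fixes p :: "nat \<Rightarrow> nat \<Rightarrow> nat \<Rightarrow> nat"
  assumes perm: "\<And>k. k < nv \<Longrightarrow> p i k permutes {..<N}" "\<And>k. k < nv \<Longrightarrow> p j k permutes {..<N}"
    and P: "\<And>k. k < nv \<Longrightarrow> P i k = mat N N (\<lambda>(r, c). if c = p i k r then 1 else 0)"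
      "\<And>k. k < nv \<Longrightarrow> P j k = mat N N (\<lambda>(r, c). if c = p j k r then 1 else 0)"
    and rc: "r < N" "c < N"
  shows "C_block nv N P i j $$ (r, c) = card {k. k < nv \<and> p i k r = p j k c}"
proof -
  have "(P i k * transpose_mat (P j k)) $$ (r, c) = (if p i k r = p j k c then 1 else 0)"
    if k: "k < nv" for k
  proof -
    \<comment> \<open>Ensures that the only index that can contribute lies in the range of
      summation.\<close>
    have "p i k r < N"
      using permutes_in_image[OF perm(1)[OF k]] rc by (metis lessThan_iff)
    have "(P i k * transpose_mat (P j k)) $$ (r, c) =
        (\<Sum>l<N. (if l = p i k r then 1 else 0) * (if l = p j k c then 1 else 0))"
      using rc by (simp add: P k scalar_prod_def lessThan_atLeast0)
    also have "\<dots> = (\<Sum>l<N. if l = p i k r then (if p i k r = p j k c then 1 else 0) else 0)"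
      by (intro sum.cong) auto
    finally show ?thesis
      using \<open>p i k r < N\<close> by simp
  qed
  then have "C_block nv N P i j $$ (r, c) = (\<Sum>k<nv. if p i k r = p j k c then 1 else 0)"
    using rc by (simp add: C_block_def)
  also have "\<dots> = card ({..<nv} \<inter> {k. p i k r = p j k c})"
    by (simp add: sum.If_cases)
  also have "{..<nv} \<inter> {k. p i k r = p j k c} = {k. k < nv \<and> p i k r = p j k c}"
    by auto
  finally show ?thesis .
qed

lemma two_le_card_iff:
  assumes "finite A"
  shows "2 \<le> card A \<longleftrightarrow> (\<exists>x\<in>A. \<exists>y\<in>A. x \<noteq> y)"
proof -
  have "2 \<le> card A \<longleftrightarrow> \<not> card A \<le> Suc 0" by linarith
  then show ?thesis using card_le_Suc0_iff_eq[OF assms] by simp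
qed

section \<open>Rectangles in \<open>H\<close>\<close>

lemma has_rectangle_permutation_blocks_iff:
  assumes perm: "\<And>i k. i < nc \<Longrightarrow> k < nv \<Longrightarrow> permutation_matrix N (P i k)"
  shows "has_rectangle (block_mat nc nv N P) \<longleftrightarrow>
    (\<exists>i<nc. \<exists>j<nc. i \<noteq> j \<and> \<not> simple_mat (C_block nv N P i j))"
proof -
  from perm have "\<forall>i k. \<exists>q. i < nc \<longrightarrow> k < nv \<longrightarrow>
      q permutes {..<N} \<and> P i k = mat N N (\<lambda>(r, c). if c = q r then 1 else 0)"
    unfolding permutation_matrix_def by blast
  then obtain p where p: "\<And>i k. i < nc \<Longrightarrow> k < nv \<Longrightarrow> p i k permutes {..<N}"
    "\<And>i k. i < nc \<Longrightarrow> k < nv \<Longrightarrow> P i k = mat N N (\<lambda>(r, c). if c = p i k r then 1 else 0)"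
    by metis
  let ?H = "block_mat nc nv N P"
  have H: "?H $$ (i * N + r, k * N + c) > 0 \<longleftrightarrow> c = p i k r"
    if "i < nc" "k < nv" "r < N" "c < N" for i k r c
    using that by (simp add: block_mat_index p)
  have lt: "p i k r < N" if "i < nc" "k < nv" "r < N" for i k r
    using permutes_in_image[OF p(1)[OF that(1,2)]] that(3) by (metis lessThan_iff)
  \<comment> \<open>The equation for \<open>k\<close> says that row \<open>r\<close> of block row
    \<open>i\<close> and row \<open>r'\<close> of block row \<open>j\<close> have their ones in
    block column \<open>k\<close> at the same place.\<close>
  have C: "\<not> simple_mat (C_block nv N P i j) \<longleftrightarrow>
      (\<exists>r<N. \<exists>r'<N. \<exists>k<nv. \<exists>k'<nv. k \<noteq> k' \<and> p i k r = p j k r' \<and> p i k' r = p j k' r')"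
    if "i < nc" "j < nc" for i j
  proof -
    have "\<not> simple_mat (C_block nv N P i j) \<longleftrightarrow>
        (\<exists>r<N. \<exists>r'<N. 2 \<le> C_block nv N P i j $$ (r, r'))"
      by (simp add: not_simple_mat_iff C_block_def cong: conj_cong)
    also have "\<dots> \<longleftrightarrow> (\<exists>r<N. \<exists>r'<N. 2 \<le> card {k. k < nv \<and> p i k r = p j k r'})"
      using C_block_index[of nv p i N j P] p that by (simp cong: conj_cong)
    finally show ?thesis
      by (auto simp: two_le_card_iff)
  qed
  show ?thesis
  proof
    assume "has_rectangle ?H"
    then obtain a a' b b' where ab: "a < nc * N" "a' < nc * N" "b < nv * N" "b' < nv * N"
      "a \<noteq> a'" "b \<noteq> b'"
      and pos: "?H $$ (a, b) > 0" "?H $$ (a, b') > 0" "?H $$ (a', b) > 0" "?H $$ (a', b') > 0"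
      by (auto simp: has_rectangle_def block_mat_def)
    obtain i r where i: "i < nc" "r < N" "a = i * N + r" using ab(1) by (rule block_index_cases)
    obtain j r' where j: "j < nc" "r' < N" "a' = j * N + r'" using ab(2) by (rule block_index_cases)
    obtain k c where k: "k < nv" "c < N" "b = k * N + c" using ab(3) by (rule block_index_cases)
    obtain k' c' where k': "k' < nv" "c' < N" "b' = k' * N + c'"
      using ab(4) by (rule block_index_cases)
    have eqs: "c = p i k r" "c' = p i k' r" "c = p j k r'" "c' = p j k' r'"
      using pos i j k k' H by auto
    \<comment> \<open>A row has only one nonzero entry per block column, so \<open>k = k'\<close>
      would force \<open>b = b'\<close>.\<close>
    have "k \<noteq> k'" using eqs ab k k' by auto
    moreover have "i \<noteq> j"
    proof
      assume "i = j"
      \<comment> \<open>Dually, a column has only one nonzero entry per block row, by injectivity of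
        \<open>p i k\<close>.\<close>
      then have "r = r'"
        using eqs permutes_inj[OF p(1)[OF i(1) k(1)]] by (metis injD)
      with \<open>i = j\<close> i j ab show False by simp
    qed
    ultimately show "\<exists>i<nc. \<exists>j<nc. i \<noteq> j \<and> \<not> simple_mat (C_block nv N P i j)"
      using C[OF i(1) j(1)] i j k k' eqs by metis
  next
    assume "\<exists>i<nc. \<exists>j<nc. i \<noteq> j \<and> \<not> simple_mat (C_block nv N P i j)"
    then obtain i j r r' k k' where ij: "i < nc" "j < nc" "i \<noteq> j" "r < N" "r' < N"
      and k: "k < nv" "k' < nv" "k \<noteq> k'" "p i k r = p j k r'" "p i k' r = p j k' r'"
      using C by metis
    \<comment> \<open>Stated with fresh variables because it is applied to rows and to columns;
      division by \<open>N\<close> recovers the block index.\<close>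
    have block_neq: "i * N + r \<noteq> j * N + r'" if "i \<noteq> j" "r < N" "r' < N" for i j r r'
    proof
      assume "i * N + r = j * N + r'"
      then have "(i * N + r) div N = (j * N + r') div N" by (rule arg_cong)
      with that show False by simp
    qed
    \<comment> \<open>The places inside block columns \<open>k\<close> and \<open>k'\<close> where
      the two rows share a one.\<close>
    let ?c = "p i k r" and ?c' = "p i k' r"
    let ?a = "i * N + r" and ?a' = "j * N + r'" and ?b = "k * N + ?c" and ?b' = "k' * N + ?c'"
    have c: "?c < N" "?c' < N"
      using lt ij(1,4) k(1,2) by simp_all
    have "?a \<noteq> ?a'" "?b \<noteq> ?b'"
      using block_neq[OF ij(3-5)] block_neq[OF k(3) c] .
    moreover have "?a < dim_row ?H" "?a' < dim_row ?H" "?b < dim_col ?H" "?b' < dim_col ?H"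
      using ij k(1,2) c by (simp_all add: block_mat_def block_index_less)
    moreover have "?H $$ (?a, ?b) > 0" "?H $$ (?a, ?b') > 0" "?H $$ (?a', ?b) > 0" "?H $$ (?a', ?b') > 0"
      using H[OF ij(1) k(1) ij(4) c(1)] H[OF ij(1) k(2) ij(4) c(2)]
        H[OF ij(2) k(1) ij(5) c(1)] H[OF ij(2) k(2) ij(5) c(2)] k(4,5) by simp_all
    ultimately show "has_rectangle ?H"
      unfolding has_rectangle_def by blast
  qed
qed

section \<open>Equivalence of the four conditions\<close>

theorem theorem6:
  fixes nc nv N :: nat and P :: "nat \<Rightarrow> nat \<Rightarrow> nat mat"
  assumes "nc \<ge> 2" and "nv \<ge> 1" and "N \<ge> 1"
    and "\<And>i j. i < nc \<Longrightarrow> j < nv \<Longrightarrow> permutation_matrix N (P i j)"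
  shows "(girth (block_mat nc nv N P) > 4
            \<longleftrightarrow> (\<forall>i<nc. \<forall>j<nc. i \<noteq> j \<longrightarrow> triangle_mat (C_block nv N P i j) (0\<^sub>m N N) = 0\<^sub>m N N))
       \<and> ((\<forall>i<nc. \<forall>j<nc. i \<noteq> j \<longrightarrow> triangle_mat (C_block nv N P i j) (0\<^sub>m N N) = 0\<^sub>m N N)
            \<longleftrightarrow> (\<forall>i<nc. \<forall>j<nc. i \<noteq> j \<longrightarrow> \<not> has_multiple_edges (tanner_graph (C_block nv N P i j))))
       \<and> ((\<forall>i<nc. \<forall>j<nc. i \<noteq> j \<longrightarrow> \<not> has_multiple_edges (tanner_graph (C_block nv N P i j)))
            \<longleftrightarrow> girth (C_mat nc nv N P) > 2)"
proof -
  have "simple_mat (P i k)" "P i k \<in> carrier_mat N N" if "i < nc" "k < nv" for i k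
    using assms(4)[OF that] by (auto simp: permutation_matrix_def simple_mat_def)
  then have "simple_mat (block_mat nc nv N P)"
    by (simp add: simple_mat_block_mat_iff)
  then have a: "girth (block_mat nc nv N P) > 4 \<longleftrightarrow>
      (\<forall>i<nc. \<forall>j<nc. i \<noteq> j \<longrightarrow> simple_mat (C_block nv N P i j))"
    using has_rectangle_permutation_blocks_iff[of nc nv N P] assms(4)
    by (auto simp: girth_gt_4_iff)
  have carrier: "C_block nv N P i j \<in> carrier_mat N N" for i j
    by (simp add: C_block_def)
  \<comment> \<open>The zero diagonal blocks impose no condition, which leaves exactly the pairs of
    distinct \<open>i\<close> and \<open>j\<close>.\<close>
  have "simple_mat (0\<^sub>m N N)"
    by (simp add: simple_mat_def)
  then have d: "girth (C_mat nc nv N P) > 2 \<longleftrightarrow>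
      (\<forall>i<nc. \<forall>j<nc. i \<noteq> j \<longrightarrow> simple_mat (C_block nv N P i j))"
    using carrier by (auto simp: girth_gt_2_iff C_mat_def simple_mat_block_mat_iff)
  show ?thesis
    by (simp add: a d triangle_mat_zero_iff[OF carrier] has_multiple_edges_tanner_graph_iff)
qed

end
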